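(* Let $0<p<\infty$ and let $\sigma_1,\sigma_2$ be weight functions on $T$. There are no isometric weighted composition operators $W_{\psi,\varphi}:\mathbb{T}_{\sigma_1,p}\to\mathbb{T}_{\sigma_2,\infty}$; that is, for no self map $\varphi:T\to T$ and function $\psi:T\to\mathbb{C}$ is the operator $W_{\psi,\varphi}(f)=\psi\,(f\circ\varphi)$ an isometry from $\mathbb{T}_{\sigma_1,p}$ into $\mathbb{T}_{\sigma_2,\infty}$.
   Context: $T$ is an infinite rooted tree, identified with its vertex set; $|x|$ is the edge-counting distance from the root $o$ to the vertex $x$; $c_n$ is the number of vertices $x$ with $|x|=n$, $n\in\mathbb{N}_0=\{0,1,2,\dots\}$. Standing assumptions: every $c_n$ is finite and the sequence $\{c_n\}$ is unbounded. A weight function is a function $\sigma:T\to(0,\infty)$. For a weight $\sigma$, $0<p<\infty$ and $f:T\to\mathbb{C}$, put $M_{\sigma,p}(n,f)=\left(\frac{1}{c_n}\sum_{|x|=n}\sigma(x)^p|f(x)|^p\right)^{1/p}$ and $\|f\|_{\sigma,p}=\sup_{n\in\mathbb{N}_0}M_{\sigma,p}(n,f)$; for $p=\infty$ put $\|f\|_{\sigma,\infty}=\sup_{x\in T}\sigma(x)|f(x)|$. The space $\mathbb{T}_{\sigma,p}$ is the set of all $f:T\to\mathbb{C}$ with $\|f\|_{\sigma,p}<\infty$. A linear operator $A:X\to Y$ between such spaces is an isometry if it maps $X$ into $Y$ and $\|Af\|_Y=\|f\|_X$ for all $f\in X$ (surjectivity is not required). *)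

theory Defs
  imports Complex_Main "HOL-Library.Extended_Nonnegative_Real"
begin

text \<open>
  A graph is given by the adjacency relation on its vertices; the vertex set is the whole
  type \<open>'v\<close>, so that functions on the tree are just functions on \<open>'v\<close>.
\<close>

definition graph_cycle :: "('v \<Rightarrow> 'v \<Rightarrow> bool) \<Rightarrow> 'v list \<Rightarrow> bool" where
  "graph_cycle adj c \<longleftrightarrow>
     3 \<le> length c \<and> distinct c \<and> successively adj c \<and> adj (last c) (hd c)"

definition graph_tree :: "('v \<Rightarrow> 'v \<Rightarrow> bool) \<Rightarrow> bool" where
  "graph_tree adj \<longleftrightarrow>
     symp adj \<and> irreflp adj \<and> (\<forall>x y. adj\<^sup>*\<^sup>* x y) \<and> \<not> (\<exists>c. graph_cycle adj c)"

text \<open>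
  The relational power \<open>(adj ^^ n) x y\<close> says that there is a walk with \<open>n\<close> edges
  from \<open>x\<close> to \<open>y\<close>.
\<close>

definition depth :: "('v \<Rightarrow> 'v \<Rightarrow> bool) \<Rightarrow> 'v \<Rightarrow> 'v \<Rightarrow> nat" where
  "depth adj r x = (LEAST n. (adj ^^ n) r x)"

definition level :: "('v \<Rightarrow> 'v \<Rightarrow> bool) \<Rightarrow> 'v \<Rightarrow> nat \<Rightarrow> 'v set" where
  "level adj r n = {x. depth adj r x = n}"

locale unbounded_rooted_tree =
  fixes adj :: "'v \<Rightarrow> 'v \<Rightarrow> bool" and r :: 'v
  assumes tree: "graph_tree adj"
    and infinite_verts: "infinite (UNIV :: 'v set)"
    and finite_level: "\<And>n. finite (level adj r n)"
    and unbounded_card_level: "\<not> bdd_above (range (\<lambda>n. card (level adj r n)))"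

definition weight :: "('v \<Rightarrow> real) \<Rightarrow> bool" where
  "weight \<sigma> \<longleftrightarrow> (\<forall>x. 0 < \<sigma> x)"

definition wmean ::
  "('v \<Rightarrow> 'v \<Rightarrow> bool) \<Rightarrow> 'v \<Rightarrow> ('v \<Rightarrow> real) \<Rightarrow> real \<Rightarrow> nat \<Rightarrow> ('v \<Rightarrow> complex) \<Rightarrow> real" where
  "wmean adj r \<sigma> p n f =
     (1 / real (card (level adj r n)) *
       (\<Sum>x\<in>level adj r n. \<sigma> x powr p * cmod (f x) powr p)) powr (1 / p)"

text \<open>
  The norms take values in \<open>[0, \<infinity>]\<close>, so that the suprema of unbounded families are \<open>\<infinity>\<close>.
\<close>

definition wnorm ::
  "('v \<Rightarrow> 'v \<Rightarrow> bool) \<Rightarrow> 'v \<Rightarrow> ('v \<Rightarrow> real) \<Rightarrow> real \<Rightarrow> ('v \<Rightarrow> complex) \<Rightarrow> ennreal" where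
  "wnorm adj r \<sigma> p f = (SUP n. ennreal (wmean adj r \<sigma> p n f))"

definition wnorm_inf :: "('v \<Rightarrow> real) \<Rightarrow> ('v \<Rightarrow> complex) \<Rightarrow> ennreal" where
  "wnorm_inf \<sigma> f = (SUP x. ennreal (\<sigma> x * cmod (f x)))"

definition wspace ::
  "('v \<Rightarrow> 'v \<Rightarrow> bool) \<Rightarrow> 'v \<Rightarrow> ('v \<Rightarrow> real) \<Rightarrow> real \<Rightarrow> ('v \<Rightarrow> complex) set" where
  "wspace adj r \<sigma> p = {f. wnorm adj r \<sigma> p f < \<infinity>}"

definition wspace_inf :: "('v \<Rightarrow> real) \<Rightarrow> ('v \<Rightarrow> complex) set" where
  "wspace_inf \<sigma> = {f. wnorm_inf \<sigma> f < \<infinity>}"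

definition weighted_comp_op ::
  "('v \<Rightarrow> complex) \<Rightarrow> ('v \<Rightarrow> 'v) \<Rightarrow> ('v \<Rightarrow> complex) \<Rightarrow> 'v \<Rightarrow> complex" where
  "weighted_comp_op \<psi> \<phi> f = (\<lambda>x. \<psi> x * f (\<phi> x))"

text \<open>
  Linearity is not part of this predicate; weighted composition operators are linear for
  every choice of the two symbols.
\<close>

definition isometry_into ::
  "'f set \<Rightarrow> ('f \<Rightarrow> ennreal) \<Rightarrow> 'g set \<Rightarrow> ('g \<Rightarrow> ennreal) \<Rightarrow> ('f \<Rightarrow> 'g) \<Rightarrow> bool" where
  "isometry_into X normX Y normY A \<longleftrightarrow>
     (\<forall>f\<in>X. A f \<in> Y) \<and> (\<forall>f\<in>X. normY (A f) = normX f)"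

end

theory Submission
  imports Defs
begin

text \<open>
  For a set \<open>A\<close> of vertices in level \<open>n\<close>, the function equal to \<open>1 / \<sigma>\<^sub>1\<close> on \<open>A\<close> and to
  \<open>0\<close> elsewhere has norm \<open>(card A / c\<^sub>n)\<^bsup>1/p\<^esup>\<close>. In the target space, the norm of the image
  of such a function is the supremum over \<open>v \<in> A\<close> of the norms of the images for the
  singletons \<open>{v}\<close>, because the fibres of \<open>\<phi>\<close> are disjoint. With \<open>A\<close> a whole level of at
  least two vertices, an isometry would give \<open>1 \<le> (1 / c\<^sub>n)\<^bsup>1/p\<^esup> < 1\<close>.
\<close>

definition recip_on :: "('v \<Rightarrow> real) \<Rightarrow> 'v set \<Rightarrow> 'v \<Rightarrow> complex" where
  "recip_on \<sigma> A x = (if x \<in> A then of_real (1 / \<sigma> x) else 0)"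

text \<open>On every other level the sum vanishes, so the mean there is
  \<open>0 powr (1 / p) = 0\<close>, and the supremum is attained at level \<open>n\<close>.\<close>

lemma wnorm_supported_on_level:
  assumes "\<And>x. x \<notin> level adj r n \<Longrightarrow> f x = 0"
  shows "wnorm adj r \<sigma> p f = ennreal (wmean adj r \<sigma> p n f)"
  unfolding wnorm_def
proof (intro antisym SUP_least SUP_upper UNIV_I)
  fix m
  have "wmean adj r \<sigma> p m f = 0" if "m \<noteq> n"
  proof -
    have "f x = 0" if "x \<in> level adj r m" for x
      using assms that \<open>m \<noteq> n\<close> by (auto simp: level_def)
    then show ?thesis
      by (simp add: wmean_def)
  qed
  then show "ennreal (wmean adj r \<sigma> p m f) \<le> ennreal (wmean adj r \<sigma> p n f)"
    by (cases "m = n") auto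
qed

lemma wnorm_recip_on:
  assumes "weight \<sigma>" and "finite (level adj r n)" and "A \<subseteq> level adj r n"
  shows "wnorm adj r \<sigma> p (recip_on \<sigma> A) =
    ennreal ((real (card A) / real (card (level adj r n))) powr (1 / p))"
proof -
  have pos: "0 < \<sigma> x" for x
    using assms(1) by (simp add: weight_def)
  \<comment> \<open>The weight cancels on \<open>A\<close>, and off \<open>A\<close> the factor is
    \<open>0 powr p = 0\<close>; the sum therefore counts \<open>A\<close>.\<close>
  have "\<sigma> x powr p * cmod (recip_on \<sigma> A x) powr p = (if x \<in> A then 1 else 0)" for x
    using pos[of x] by (simp add: recip_on_def norm_divide powr_divide)
  then have "(\<Sum>x\<in>level adj r n. \<sigma> x powr p * cmod (recip_on \<sigma> A x) powr p) = real (card A)"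
    using assms(2,3) by (simp add: sum.If_cases Int_absorb1)
  moreover have "wnorm adj r \<sigma> p (recip_on \<sigma> A) = ennreal (wmean adj r \<sigma> p n (recip_on \<sigma> A))"
    using assms(3) by (intro wnorm_supported_on_level) (auto simp: recip_on_def)
  ultimately show ?thesis
    by (simp add: wmean_def)
qed

text \<open>The value of the image at \<open>x\<close> depends only on the argument's value at
  \<open>\<phi> x\<close>. Hence it agrees with the image for \<open>{\<phi> x}\<close> if
  \<open>\<phi> x\<close> lies in \<open>A\<close>, and is \<open>0\<close> otherwise.\<close>

lemma wnorm_inf_weighted_comp_recip_on_le:
  assumes "\<And>v. v \<in> A \<Longrightarrow> wnorm_inf \<tau> (weighted_comp_op \<psi> \<phi> (recip_on \<sigma> {v})) \<le> K"
  shows "wnorm_inf \<tau> (weighted_comp_op \<psi> \<phi> (recip_on \<sigma> A)) \<le> K"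
  unfolding wnorm_inf_def
proof (rule SUP_least)
  fix x
  show "ennreal (\<tau> x * cmod (weighted_comp_op \<psi> \<phi> (recip_on \<sigma> A) x)) \<le> K"
  proof (cases "\<phi> x \<in> A")
    case True
    let ?g = "weighted_comp_op \<psi> \<phi> (recip_on \<sigma> {\<phi> x})"
    have "weighted_comp_op \<psi> \<phi> (recip_on \<sigma> A) x = ?g x"
      using True by (simp add: weighted_comp_op_def recip_on_def)
    moreover have "ennreal (\<tau> x * cmod (?g x)) \<le> wnorm_inf \<tau> ?g"
      unfolding wnorm_inf_def by (rule SUP_upper) simp
    ultimately show ?thesis
      using assms[OF True] by simp
  qed (simp add: weighted_comp_op_def recip_on_def)
qed

theorem theorem15:
  fixes adj :: "'v \<Rightarrow> 'v \<Rightarrow> bool" and r :: 'v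
    and p :: real and \<sigma>\<^sub>1 \<sigma>\<^sub>2 :: "'v \<Rightarrow> real"
  assumes "unbounded_rooted_tree adj r"
    and "0 < p"
    and "weight \<sigma>\<^sub>1" and "weight \<sigma>\<^sub>2"
  shows "\<not> (\<exists>(\<phi> :: 'v \<Rightarrow> 'v) (\<psi> :: 'v \<Rightarrow> complex).
            isometry_into (wspace adj r \<sigma>\<^sub>1 p) (wnorm adj r \<sigma>\<^sub>1 p)
              (wspace_inf \<sigma>\<^sub>2) (wnorm_inf \<sigma>\<^sub>2) (weighted_comp_op \<psi> \<phi>))"
proof
  interpret unbounded_rooted_tree adj r by fact
  obtain n where "1 < card (level adj r n)"
    using unbounded_card_level by (force simp: bdd_above_def not_le)
  define L where "L = level adj r n"
  have L: "1 < card L"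
    using \<open>1 < card (level adj r n)\<close> by (simp add: L_def)
  have norm: "wnorm adj r \<sigma>\<^sub>1 p (recip_on \<sigma>\<^sub>1 A) =
      ennreal ((real (card A) / real (card L)) powr (1 / p))" if "A \<subseteq> L" for A
    using that wnorm_recip_on[OF assms(3) finite_level] by (simp add: L_def)
  assume "\<exists>\<phi> \<psi>. isometry_into (wspace adj r \<sigma>\<^sub>1 p) (wnorm adj r \<sigma>\<^sub>1 p)
      (wspace_inf \<sigma>\<^sub>2) (wnorm_inf \<sigma>\<^sub>2) (weighted_comp_op \<psi> \<phi>)"
  then obtain \<phi> \<psi> where iso: "isometry_into (wspace adj r \<sigma>\<^sub>1 p) (wnorm adj r \<sigma>\<^sub>1 p)
      (wspace_inf \<sigma>\<^sub>2) (wnorm_inf \<sigma>\<^sub>2) (weighted_comp_op \<psi> \<phi>)"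
    by blast
  \<comment> \<open>The norm computed in \<open>norm\<close> is a real number, hence finite, so the
    test function lies in the domain of the isometry.\<close>
  have image_norm: "wnorm_inf \<sigma>\<^sub>2 (weighted_comp_op \<psi> \<phi> (recip_on \<sigma>\<^sub>1 A)) =
      ennreal ((real (card A) / real (card L)) powr (1 / p))" if "A \<subseteq> L" for A
    using iso norm[OF that] by (simp add: isometry_into_def wspace_def)
  \<comment> \<open>The bound is the common image norm of all singletons in
    \<open>L\<close>.\<close>
  have "wnorm_inf \<sigma>\<^sub>2 (weighted_comp_op \<psi> \<phi> (recip_on \<sigma>\<^sub>1 L))
      \<le> ennreal ((1 / real (card L)) powr (1 / p))"
    by (rule wnorm_inf_weighted_comp_recip_on_le) (simp add: image_norm)
  \<comment> \<open>With \<open>A = L\<close> the quotient of cardinalities is 1, so the left-hand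
    norm is 1.\<close>
  then have "1 \<le> (1 / real (card L)) powr (1 / p)"
    using L by (simp add: image_norm)
  moreover have "(1 / real (card L)) powr (1 / p) < 1 powr (1 / p)"
    using L assms(2) by (intro powr_less_mono2) auto
  ultimately show False
    by simp
qed

end
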